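(* Let $A\in\mathbb{Q}_s^{m\times n}$, let $\mathcal{C}\subset\{1,\dots,n\}$ and $\mathcal{R}\subset\{1,\dots,m\}$ be index sets with $|\mathcal{C}|=|\mathcal{R}|=k$, and let $$C=A(:,\mathcal{C})\in\mathbb{Q}_s^{m\times k},\qquad R=A(\mathcal{R},:)\in\mathbb{Q}_s^{k\times n},\qquad W=A(\mathcal{R},\mathcal{C})\in\mathbb{Q}_s^{k\times k}.$$ If $\operatorname{rank}_\sigma(W)=\operatorname{rank}_\sigma(A)$, then $$W^\dagger=C^\dagger AR^\dagger\qquad\text{and}\qquad A=CW^\dagger R .$$
   Context: $\mathbb{Q}_s$ is the real algebra of split quaternions $q=q_1+q_2\mathbf{i}+q_3\mathbf{j}+q_4\mathbf{k}$ ($q_\ell\in\mathbb{R}$) with $\mathbf{i}^2=-1$, $\mathbf{j}^2=\mathbf{k}^2=1$, $\mathbf{i}\mathbf{j}=\mathbf{k}=-\mathbf{j}\mathbf{i}$, $\mathbf{j}\mathbf{k}=-\mathbf{i}=-\mathbf{k}\mathbf{j}$, $\mathbf{k}\mathbf{i}=\mathbf{j}=-\mathbf{i}\mathbf{k}$. A matrix $A\in\mathbb{Q}_s^{m\times n}$ is written $A=A_1+A_2\mathbf{i}+A_3\mathbf{j}+A_4\mathbf{k}$ with $A_\ell\in\mathbb{R}^{m\times n}$. Its real representation is $$A^\sigma=\begin{bmatrix} A_1+A_3 & -A_2+A_4 \\ A_2+A_4 & A_1-A_3 \end{bmatrix}\in\mathbb{R}^{2m\times 2n};$$ the map $\sigma: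 A\mapsto A^\sigma$ is a bijection $\mathbb{Q}_s^{m\times n}\to\mathbb{R}^{2m\times 2n}$ with inverse $\sigma^{-1}$ (for all sizes). $\operatorname{rank}_\sigma(A):=\operatorname{rank}(A^\sigma)$ (real rank). For a real matrix $M$, $M^\dagger$ is the usual real Moore--Penrose inverse; for $A\in\mathbb{Q}_s^{m\times n}$, $A^\dagger:=\sigma^{-1}((A^\sigma)^\dagger)\in\mathbb{Q}_s^{n\times m}$. $A(\mathcal{R},\mathcal{C})$ is the submatrix of $A$ with rows in $\mathcal{R}$ and columns in $\mathcal{C}$; a colon means all rows or all columns. *)

theory Defs
  imports Complex_Main "Jordan_Normal_Form.DL_Rank" "Jordan_Normal_Form.DL_Submatrix"
begin

section \<open>The real algebra of split quaternions\<close>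

datatype split_quat = Split_Quat (sq1: real) (sq2: real) (sq3: real) (sq4: real)

lemma split_quat_eq_iff:
  "p = q \<longleftrightarrow> sq1 p = sq1 q \<and> sq2 p = sq2 q \<and> sq3 p = sq3 q \<and> sq4 p = sq4 q"
  using split_quat.expand by auto

instantiation split_quat :: real_algebra_1
begin

definition "0 = Split_Quat 0 0 0 0"
definition "1 = Split_Quat 1 0 0 0"
definition "- q = Split_Quat (- sq1 q) (- sq2 q) (- sq3 q) (- sq4 q)"
definition "p + q = Split_Quat (sq1 p + sq1 q) (sq2 p + sq2 q) (sq3 p + sq3 q) (sq4 p + sq4 q)"
definition "p - q = Split_Quat (sq1 p - sq1 q) (sq2 p - sq2 q) (sq3 p - sq3 q) (sq4 p - sq4 q)"
definition "c *\<^sub>R q = Split_Quat (c * sq1 q) (c * sq2 q) (c * sq3 q) (c * sq4 q)"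

text \<open>The bilinear extension of the multiplication table of the units; see \<open>split_quat_units\<close> below.\<close>

definition "p * q = Split_Quat
  (sq1 p * sq1 q - sq2 p * sq2 q + sq3 p * sq3 q + sq4 p * sq4 q)
  (sq1 p * sq2 q + sq2 p * sq1 q - sq3 p * sq4 q + sq4 p * sq3 q)
  (sq1 p * sq3 q + sq3 p * sq1 q - sq2 p * sq4 q + sq4 p * sq2 q)
  (sq1 p * sq4 q + sq4 p * sq1 q + sq2 p * sq3 q - sq3 p * sq2 q)"

instance
  by standard
    (simp_all add: split_quat_eq_iff zero_split_quat_def one_split_quat_def uminus_split_quat_def
      plus_split_quat_def minus_split_quat_def scaleR_split_quat_def times_split_quat_def
      algebra_simps)

end

lemma split_quat_sel_simps [simp]:
  "sq1 0 = 0" "sq2 0 = 0" "sq3 0 = 0" "sq4 0 = 0"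
  "sq1 1 = 1" "sq2 1 = 0" "sq3 1 = 0" "sq4 1 = 0"
  "sq1 (- q) = - sq1 q" "sq2 (- q) = - sq2 q" "sq3 (- q) = - sq3 q" "sq4 (- q) = - sq4 q"
  "sq1 (p + q) = sq1 p + sq1 q" "sq2 (p + q) = sq2 p + sq2 q"
  "sq3 (p + q) = sq3 p + sq3 q" "sq4 (p + q) = sq4 p + sq4 q"
  "sq1 (p - q) = sq1 p - sq1 q" "sq2 (p - q) = sq2 p - sq2 q"
  "sq3 (p - q) = sq3 p - sq3 q" "sq4 (p - q) = sq4 p - sq4 q"
  "sq1 (c *\<^sub>R q) = c * sq1 q" "sq2 (c *\<^sub>R q) = c * sq2 q"
  "sq3 (c *\<^sub>R q) = c * sq3 q" "sq4 (c *\<^sub>R q) = c * sq4 q"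
  by (simp_all add: zero_split_quat_def one_split_quat_def uminus_split_quat_def
      plus_split_quat_def minus_split_quat_def scaleR_split_quat_def)

definition sq_i :: split_quat where "sq_i = Split_Quat 0 1 0 0"
definition sq_j :: split_quat where "sq_j = Split_Quat 0 0 1 0"
definition sq_k :: split_quat where "sq_k = Split_Quat 0 0 0 1"

lemma split_quat_units:
  "sq_i * sq_i = - 1" "sq_j * sq_j = 1" "sq_k * sq_k = 1"
  "sq_i * sq_j = sq_k" "sq_j * sq_i = - sq_k"
  "sq_j * sq_k = - sq_i" "sq_k * sq_j = sq_i"
  "sq_k * sq_i = sq_j" "sq_i * sq_k = - sq_j"
  by (simp_all add: sq_i_def sq_j_def sq_k_def times_split_quat_def one_split_quat_def
      uminus_split_quat_def)

lemma split_quat_expansion: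
  "q = sq1 q *\<^sub>R 1 + sq2 q *\<^sub>R sq_i + sq3 q *\<^sub>R sq_j + sq4 q *\<^sub>R sq_k"
  by (simp add: split_quat_eq_iff sq_i_def sq_j_def sq_k_def)


section \<open>Real representation of split quaternion matrices\<close>

definition real_rep :: "split_quat mat \<Rightarrow> real mat" where
  "real_rep A =
    (let A1 = map_mat sq1 A; A2 = map_mat sq2 A; A3 = map_mat sq3 A; A4 = map_mat sq4 A
     in four_block_mat (A1 + A3) (- A2 + A4) (A2 + A4) (A1 - A3))"

lemma real_rep_carrier:
  "A \<in> carrier_mat m n \<Longrightarrow> real_rep A \<in> carrier_mat (2 * m) (2 * n)"
  unfolding carrier_mat_def by (simp add: real_rep_def Let_def)

lemma real_rep_bij_betw:
  "bij_betw real_rep (carrier_mat m n) (carrier_mat (2 * m) (2 * n))"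
proof -
  define g :: "real mat \<Rightarrow> split_quat mat" where
    "g M = mat m n (\<lambda>(i, j). Split_Quat
        ((M $$ (i, j) + M $$ (m + i, n + j)) / 2)
        ((M $$ (m + i, j) - M $$ (i, n + j)) / 2)
        ((M $$ (i, j) - M $$ (m + i, n + j)) / 2)
        ((M $$ (m + i, j) + M $$ (i, n + j)) / 2))" for M
  show ?thesis
  proof (rule bij_betw_byWitness[where f' = g])
    show "\<forall>A\<in>carrier_mat m n. g (real_rep A) = A"
      by (auto intro!: eq_matI simp: g_def real_rep_def Let_def split_quat_eq_iff)
    show "\<forall>M\<in>carrier_mat (2 * m) (2 * n). real_rep (g M) = M"
      by (auto intro!: eq_matI simp: g_def real_rep_def Let_def field_simps)
    show "real_rep ` carrier_mat m n \<subseteq> carrier_mat (2 * m) (2 * n)"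
      using real_rep_carrier by blast
    show "g ` carrier_mat (2 * m) (2 * n) \<subseteq> carrier_mat m n"
      by (auto simp: g_def)
  qed
qed

text \<open>
  The sizes of the preimage are determined by those of the argument, which is assumed to have an
  even number of rows and of columns.
\<close>

definition real_rep_inv :: "real mat \<Rightarrow> split_quat mat" where
  "real_rep_inv M =
    the_inv_into (carrier_mat (dim_row M div 2) (dim_col M div 2)) real_rep M"

lemma real_rep_inv_real_rep: "real_rep_inv (real_rep A) = A"
proof -
  have A: "A \<in> carrier_mat (dim_row A) (dim_col A)" by simp
  have "dim_row (real_rep A) = 2 * dim_row A" "dim_col (real_rep A) = 2 * dim_col A"
    using real_rep_carrier[OF A] by auto
  then show ?thesis
    unfolding real_rep_inv_def
    using the_inv_into_f_f[OF bij_betw_imp_inj_on[OF real_rep_bij_betw] A] by simp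
qed

lemma real_rep_real_rep_inv:
  assumes M: "M \<in> carrier_mat (2 * m) (2 * n)"
  shows "real_rep_inv M \<in> carrier_mat m n" "real_rep (real_rep_inv M) = M"
proof -
  obtain A where "A \<in> carrier_mat m n" "M = real_rep A"
    using M bij_betw_imp_surj_on[OF real_rep_bij_betw, of m n] by blast
  then show "real_rep_inv M \<in> carrier_mat m n" "real_rep (real_rep_inv M) = M"
    by (simp_all add: real_rep_inv_real_rep)
qed

definition rank_sigma :: "split_quat mat \<Rightarrow> nat" where
  "rank_sigma A = vec_space.rank (dim_row (real_rep A)) (real_rep A)"


section \<open>Moore--Penrose inverses\<close>

definition is_mp_inverse :: "real mat \<Rightarrow> real mat \<Rightarrow> bool" where
  "is_mp_inverse M X \<longleftrightarrow>
     X \<in> carrier_mat (dim_col M) (dim_row M) \<and>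
     M * X * M = M \<and>
     X * M * X = X \<and>
     transpose_mat (M * X) = M * X \<and>
     transpose_mat (X * M) = X * M"

lemma is_mp_inverse_unique:
  assumes X: "is_mp_inverse M X" and Y: "is_mp_inverse M Y"
  shows "X = Y"
proof -
  define m n where "m = dim_row M" and "n = dim_col M"
  have c: "M \<in> carrier_mat m n" "X \<in> carrier_mat n m" "Y \<in> carrier_mat n m"
    using X Y by (auto simp: is_mp_inverse_def m_def n_def)
  have x: "M * X * M = M" "X * M * X = X" "transpose_mat (M * X) = M * X"
      "transpose_mat (X * M) = X * M"
    and y: "M * Y * M = M" "Y * M * Y = Y" "transpose_mat (M * Y) = M * Y"
      "transpose_mat (Y * M) = Y * M"
    using X Y by (auto simp: is_mp_inverse_def)
  have MX: "M * X \<in> carrier_mat m m" and MY: "M * Y \<in> carrier_mat m m"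
    and XM: "X * M \<in> carrier_mat n n" and YM: "Y * M \<in> carrier_mat n n"
    using mult_carrier_mat[OF c(1,2)] mult_carrier_mat[OF c(1,3)]
      mult_carrier_mat[OF c(2,1)] mult_carrier_mat[OF c(3,1)] by simp_all
  have "M * X = M * Y * M * X"
    using y(1) by simp
  also have "\<dots> = M * Y * (M * X)"
    by (rule assoc_mult_mat[OF MY c(1,2)])
  finally have "transpose_mat (M * X) = transpose_mat (M * X) * transpose_mat (M * Y)"
    using transpose_mult[OF MY MX] by simp
  then have "M * X = M * X * (M * Y)"
    using x(3) y(3) by simp
  also have "\<dots> = M * X * M * Y"
    by (rule assoc_mult_mat[OF MX c(1,3), symmetric])
  finally have l: "M * X = M * Y"
    using x(1) by simp
  have "X * M = X * (M * Y * M)"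
    using y(1) by simp
  also have "\<dots> = X * (M * (Y * M))"
    by (simp add: assoc_mult_mat[OF c(1,3,1)])
  also have "\<dots> = X * M * (Y * M)"
    by (rule assoc_mult_mat[OF c(2,1) YM, symmetric])
  finally have "transpose_mat (X * M) = transpose_mat (Y * M) * transpose_mat (X * M)"
    using transpose_mult[OF XM YM] by simp
  then have "X * M = Y * M * (X * M)"
    using x(4) y(4) by simp
  also have "\<dots> = Y * (M * (X * M))"
    by (rule assoc_mult_mat[OF c(3,1) XM])
  also have "\<dots> = Y * (M * X * M)"
    by (simp add: assoc_mult_mat[OF c(1,2,1)])
  finally have r: "X * M = Y * M"
    using x(1) by simp
  have "X = X * (M * X)"
    using x(2) assoc_mult_mat[OF c(2,1,2)] by simp
  also have "\<dots> = X * (M * Y)"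
    using l by simp
  also have "\<dots> = X * M * Y"
    by (rule assoc_mult_mat[OF c(2,1,3), symmetric])
  also have "\<dots> = Y"
    using r y(2) by simp
  finally show ?thesis .
qed

definition mp_inverse :: "real mat \<Rightarrow> real mat" where
  "mp_inverse M = (THE X. is_mp_inverse M X)"

definition sq_mp_inverse :: "split_quat mat \<Rightarrow> split_quat mat" where
  "sq_mp_inverse A = real_rep_inv (mp_inverse (real_rep A))"

end

theory Submission
  imports Defs
begin

text \<open>
  The real representation is an injective homomorphism and \<open>C = A P\<close>, \<open>R = Q A\<close>, \<open>W = Q A P\<close> for
  submatrices \<open>P\<close>, \<open>Q\<close> of identity matrices, so it suffices to treat real matrices and arbitrary
  \<open>P\<close>, \<open>Q\<close>. There the rank condition gives \<open>A = C Y\<close> and \<open>A = Z R\<close>, hence \<open>C = Z W\<close> and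
  \<open>R = W Y\<close>, and \<open>C W\<^sup>\<dagger> R = Z W W\<^sup>\<dagger> W Y = Z W Y = A\<close>. Since \<open>W = Q C = R P\<close>, the projections
  \<open>C\<^sup>\<dagger> C\<close> and \<open>R R\<^sup>\<dagger>\<close> fix \<open>W\<^sup>\<dagger>\<close> from the left and from the right, so that
  \<open>C\<^sup>\<dagger> A R\<^sup>\<dagger> = (C\<^sup>\<dagger> C) W\<^sup>\<dagger> (R R\<^sup>\<dagger>) = W\<^sup>\<dagger>\<close>.
  The facts on ranks and the existence of Moore--Penrose inverses come from a factorization
  \<open>M = B Z\<close> with \<open>B = M Y\<close> of full column rank.
\<close>

section \<open>Full column rank, expressed as a trivial kernel\<close>

definition trivial_kernel :: "'a :: field mat \<Rightarrow> bool" where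
  "trivial_kernel A \<longleftrightarrow>
     (\<forall>v \<in> carrier_vec (dim_col A). A *\<^sub>v v = 0\<^sub>v (dim_row A) \<longrightarrow> v = 0\<^sub>v (dim_col A))"

lemma trivial_kernel_mult_right:
  assumes "A \<in> carrier_mat m n" "B \<in> carrier_mat n k" "trivial_kernel (A * B)"
  shows "trivial_kernel B"
  unfolding trivial_kernel_def
proof (intro ballI impI)
  fix v :: "'a vec"
  assume v: "v \<in> carrier_vec (dim_col B)" and z: "B *\<^sub>v v = 0\<^sub>v (dim_row B)"
  have "(A * B) *\<^sub>v v = A *\<^sub>v (B *\<^sub>v v)"
    using assms v by (intro assoc_mult_mat_vec) auto
  also have "\<dots> = 0\<^sub>v m"
    using assms z by (auto intro!: eq_vecI)
  finally show "v = 0\<^sub>v (dim_col B)"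
    using assms v by (auto simp: trivial_kernel_def)
qed

lemma trivial_kernel_imp_right_inverse:
  fixes T :: "'a :: field mat"
  assumes T: "T \<in> carrier_mat r r" "trivial_kernel T"
  obtains T' where "T' \<in> carrier_mat r r" "T * T' = 1\<^sub>m r"
proof -
  have "det T \<noteq> 0"
    using T det_0_iff_vec_prod_zero_field[OF T(1)] by (auto simp: trivial_kernel_def)
  from det_non_zero_imp_unit[OF T(1) this, of "()"] show ?thesis
    using that by (auto simp: Units_def ring_mat_def)
qed

text \<open>If \<open>s < r\<close>, padding \<open>N\<close> with zero rows gives a square matrix
  \<open>A\<close> with determinant 0. A nonzero vector in the kernel of \<open>A\<close> is also
  killed by \<open>N\<close>, whose rows are the first \<open>s\<close> rows of
  \<open>A\<close>.\<close>

lemma trivial_kernel_imp_le: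
  fixes N :: "'a :: field mat"
  assumes N: "N \<in> carrier_mat s r" "trivial_kernel N"
  shows "r \<le> s"
proof (rule ccontr)
  assume "\<not> r \<le> s"
  then have sr: "s < r" by simp
  define A where "A = mat r r (\<lambda>(i, j). if i < s then N $$ (i, j) else 0)"
  have A: "A \<in> carrier_mat r r" by (simp add: A_def)
  \<comment> \<open>Row \<open>s\<close> of \<open>A\<close> is the first padded row, and it is what
    the transpose makes of the unit vector with index \<open>s\<close>.\<close>
  have "transpose_mat A *\<^sub>v unit_vec r s = 0\<^sub>v r"
    using A sr by (intro eq_vecI) (auto simp: A_def col_def)
  moreover have "unit_vec r s \<noteq> (0\<^sub>v r :: 'a vec)"
    using sr by (simp add: unit_vec_nonzero)
  ultimately have "det (transpose_mat A) = 0"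
    using A det_0_iff_vec_prod_zero_field[of "transpose_mat A" r] unit_vec_carrier[of r s]
    by (metis transpose_carrier_mat)
  then have "det A = 0"
    using det_transpose[OF A] by simp
  then obtain v where v: "v \<in> carrier_vec r" "v \<noteq> 0\<^sub>v r" "A *\<^sub>v v = 0\<^sub>v r"
    using det_0_iff_vec_prod_zero_field[OF A] by auto
  have "N *\<^sub>v v = 0\<^sub>v s"
  proof (rule eq_vecI)
    fix i assume i: "i < dim_vec (0\<^sub>v s :: 'a vec)"
    then have "row A i = row N i"
      using N sr by (intro eq_vecI) (auto simp: A_def)
    then have "(N *\<^sub>v v) $ i = (A *\<^sub>v v) $ i"
      using i N A sr by simp
    then show "(N *\<^sub>v v) $ i = (0\<^sub>v s :: 'a vec) $ i"
      using v i sr by simp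
  qed (use N in simp)
  then show False
    using N v by (auto simp: trivial_kernel_def)
qed

section \<open>Factorization through a basis of the column space\<close>

context vec_space
begin

lemma col_space_subset_imp_factor:
  assumes A: "A \<in> carrier_mat n k" and B: "B \<in> carrier_mat n l"
    and sub: "set (cols A) \<subseteq> col_space B"
  obtains Y where "Y \<in> carrier_mat l k" "A = B * Y"
proof -
  have "\<exists>y \<in> carrier_vec l. B *\<^sub>v y = col A j" if "j < k" for j
  proof -
    have "col A j \<in> col_space B"
      using sub that A by (auto simp: cols_def)
    then show ?thesis
      using B by (auto simp: col_space_eq[OF B])
  qed
  then obtain y where y: "\<And>j. j < k \<Longrightarrow> y j \<in> carrier_vec l \<and> B *\<^sub>v y j = col A j"
    by metis
  define Y where "Y = mat_of_cols l (map y [0..<k])"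
  have Y: "Y \<in> carrier_mat l k" by (auto simp: Y_def)
  have "col (B * Y) j = col A j" if "j < k" for j
  proof -
    have "col Y j = y j"
      using that y unfolding Y_def by (subst col_mat_of_cols) auto
    then show ?thesis
      using col_mult2[OF B Y that] y[OF that] by metis
  qed
  then have "A = B * Y"
    using A B Y by (intro mat_col_eqI) auto
  with Y that show ?thesis by blast
qed

text \<open>The columns of \<open>B\<close> form a maximal independent set of columns of
  \<open>M\<close>, and \<open>Z\<close> holds the coordinates of all columns of \<open>M\<close> in
  this basis. The matrix \<open>Y\<close> exists because the columns of \<open>B\<close> lie in the
  column space of \<open>M\<close>; through \<open>B = M * Y\<close>, the trivial kernel of
  \<open>B\<close> yields information on the factors of \<open>M\<close>.\<close>

lemma full_rank_factorization:
  assumes M: "M \<in> carrier_mat n k"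
  obtains B Y Z where "B \<in> carrier_mat n (rank M)" "Z \<in> carrier_mat (rank M) k"
    "Y \<in> carrier_mat k (rank M)" "M = B * Z" "B = M * Y" "trivial_kernel B"
proof -
  have carr: "set (cols M) \<subseteq> carrier_vec n"
    using M cols_dim by blast
  obtain S where S: "maximal S (\<lambda>T. T \<subseteq> set (cols M) \<and> lin_indpt T)" "finite S"
    using maximal_exists_superset[of "set (cols M)" "\<lambda>T. T \<subseteq> set (cols M) \<and> lin_indpt T" "{}"]
      finite_lin_indpt2[of "{}"] by auto
  then have SM: "S \<subseteq> set (cols M)" and indpt: "lin_indpt S"
    by (auto simp: maximal_def)
  obtain bs where bs: "set bs = S" "distinct bs"
    using finite_distinct_list[OF S(2)] by blast
  have len: "length bs = rank M"
    using rank_card_indpt[OF M S(1)] distinct_card[OF bs(2)] bs(1) by simp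
  define B where "B = mat_of_cols n bs"
  have B: "B \<in> carrier_mat n (rank M)"
    using len by (auto simp: B_def)
  have colsB: "cols B = bs"
    unfolding B_def using SM carr bs by (intro cols_mat_of_cols) auto
  have "set (cols M) \<subseteq> span S"
  proof
    fix s assume s: "s \<in> set (cols M)"
    show "s \<in> span S"
    proof (rule ccontr)
      assume ns: "s \<notin> span S"
      have Sc: "S \<subseteq> carrier_vec n" using SM carr by auto
      have "s \<notin> S" using ns span_mem[OF Sc] by blast
      moreover have "lin_indpt (insert s S)"
        using lin_dep_iff_in_span[OF Sc indpt _ \<open>s \<notin> S\<close>] ns s carr by auto
      ultimately show False
        using S(1) s SM unfolding maximal_def by blast
    qed
  qed
  then obtain Z where Z: "Z \<in> carrier_mat (rank M) k" "M = B * Z"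
    using col_space_subset_imp_factor[OF M B] colsB bs by (auto simp: col_space_def)
  have "set (cols B) \<subseteq> span (set (cols M))"
    using SM colsB bs span_mem carr by auto
  then obtain Y where Y: "Y \<in> carrier_mat k (rank M)" "B = M * Y"
    using col_space_subset_imp_factor[OF B M] by (auto simp: col_space_def)
  \<comment> \<open>The columns \<open>bs\<close> are distinct, so a nonzero kernel vector would be
    a linear dependence in the set \<open>S\<close>.\<close>
  have "trivial_kernel B"
    unfolding trivial_kernel_def
    using lin_depI[OF B] indpt colsB bs B by auto
  with that B Z Y show ?thesis by blast
qed

end

section \<open>Ranks of products and transposes\<close>

abbreviation mat_rank :: "'a :: field mat \<Rightarrow> nat" where
  "mat_rank M \<equiv> vec_space.rank (dim_row M) M"

text \<open>A full column rank matrix \<open>B' = B * Z * Y'\<close> with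
  \<open>mat_rank (B * Z)\<close> columns forces its right factor \<open>Z * Y'\<close> to have
  trivial kernel as well. That factor has only \<open>s\<close> rows, so it has at most
  \<open>s\<close> columns.\<close>

lemma mat_rank_mult_le:
  fixes B :: "'a :: field mat"
  assumes B: "B \<in> carrier_mat m s" and Z: "Z \<in> carrier_mat s n"
  shows "mat_rank (B * Z) \<le> s"
proof -
  have M: "B * Z \<in> carrier_mat m n" using B Z by simp
  obtain B' Y' where B': "B' \<in> carrier_mat m (mat_rank (B * Z))"
    and Y': "Y' \<in> carrier_mat n (mat_rank (B * Z))" "B' = B * Z * Y'" "trivial_kernel B'"
    using vec_space.full_rank_factorization[OF M] M by (metis carrier_matD(1))
  have "B' = B * (Z * Y')"
    using B Z Y' by (simp add: assoc_mult_mat[of _ m s _ n _ "mat_rank (B * Z)"])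
  then have "trivial_kernel (Z * Y')"
    using trivial_kernel_mult_right[OF B mult_carrier_mat[OF Z Y'(1)]] Y'(3) by simp
  then show ?thesis
    using trivial_kernel_imp_le[of "Z * Y'" s] Z Y' by auto
qed

text \<open>Transposing \<open>M = B * Z\<close> factors the transpose through the same inner
  dimension \<open>mat_rank M\<close>, which bounds its rank. Applying this bound to the transpose
  gives the converse inequality.\<close>

lemma mat_rank_transpose:
  fixes M :: "'a :: field mat"
  shows "mat_rank (transpose_mat M) = mat_rank M"
proof -
  have le: "mat_rank (transpose_mat M) \<le> mat_rank M" for M :: "'a mat"
  proof -
    have M: "M \<in> carrier_mat (dim_row M) (dim_col M)" by simp
    obtain B Z where "B \<in> carrier_mat (dim_row M) (mat_rank M)"
      "Z \<in> carrier_mat (mat_rank M) (dim_col M)" "M = B * Z"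
      using vec_space.full_rank_factorization[OF M] by metis
    then show ?thesis
      using mat_rank_mult_le[of "transpose_mat Z" "dim_col M" "mat_rank M" "transpose_mat B" "dim_row M"]
      by (metis transpose_mult transpose_carrier_mat)
  qed
  show ?thesis
    using le[of M] le[of "transpose_mat M"] by simp
qed

lemma mat_rank_mult_le_left:
  fixes A :: "'a :: field mat"
  assumes A: "A \<in> carrier_mat m n" and P: "P \<in> carrier_mat n k"
  shows "mat_rank (A * P) \<le> mat_rank A"
proof -
  obtain B Z where B: "B \<in> carrier_mat m (mat_rank A)"
    and Z: "Z \<in> carrier_mat (mat_rank A) n" and eq: "A = B * Z"
    using vec_space.full_rank_factorization[OF A] A by (metis carrier_matD(1))
  then have "A * P = B * (Z * P)"
    using assoc_mult_mat[OF B Z P] by simp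
  then show ?thesis
    using mat_rank_mult_le[OF B mult_carrier_mat[OF Z P]] by simp
qed

lemma mat_rank_mult_le_right:
  fixes A :: "'a :: field mat"
  assumes A: "A \<in> carrier_mat m n" and Q: "Q \<in> carrier_mat k m"
  shows "mat_rank (Q * A) \<le> mat_rank A"
  using mat_rank_mult_le_left[of "transpose_mat A" n m "transpose_mat Q" k] A Q
  by (metis mat_rank_transpose transpose_carrier_mat transpose_mult)

text \<open>With \<open>A = B * Z\<close> and a basis \<open>B'\<close> of the column space of
  \<open>A * P\<close>, equality of the ranks makes the matrix \<open>T\<close> that expresses
  \<open>B'\<close> through \<open>B\<close> square. It has trivial kernel, so it can be inverted
  and \<open>B\<close>, hence \<open>A\<close>, is recovered from \<open>A * P\<close>.\<close>

lemma mat_rank_mult_eq_imp_factor: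
  fixes A :: "'a :: field mat"
  assumes A: "A \<in> carrier_mat m n" and P: "P \<in> carrier_mat n k"
    and rank: "mat_rank (A * P) = mat_rank A"
  obtains Y where "Y \<in> carrier_mat k n" "A = A * P * Y"
proof -
  define r where "r = mat_rank A"
  have AP: "A * P \<in> carrier_mat m k" using A P by simp
  obtain B Z where B: "B \<in> carrier_mat m r" and Z: "Z \<in> carrier_mat r n" and A_eq: "A = B * Z"
    using vec_space.full_rank_factorization[OF A] A unfolding r_def by (metis carrier_matD(1))
  obtain B' Y where B': "B' \<in> carrier_mat m r" and Y: "Y \<in> carrier_mat k r"
    and B'_eq: "B' = A * P * Y" and ker: "trivial_kernel B'"
    using vec_space.full_rank_factorization[OF AP] A rank unfolding r_def
    by (metis carrier_matD(1) index_mult_mat(2))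
  define T where "T = Z * P * Y"
  have T: "T \<in> carrier_mat r r" using Z P Y by (simp add: T_def)
  have BT: "B' = B * T"
    using B Z P Y by (simp add: T_def B'_eq A_eq assoc_mult_mat[of _ m r _ n _ k]
      assoc_mult_mat[of _ m r _ k _ r])
  obtain T' where T': "T' \<in> carrier_mat r r" "T * T' = 1\<^sub>m r"
    using trivial_kernel_imp_right_inverse[OF T] trivial_kernel_mult_right[OF B T] ker BT by metis
  \<comment> \<open>The factor is \<open>Y * T' * Z\<close>: \<open>Y\<close> produces
    \<open>B'\<close> from \<open>A * P\<close>, \<open>T'\<close> turns \<open>B' = B * T\<close>
    into \<open>B\<close>, and \<open>Z\<close> turns \<open>B\<close> into
    \<open>A\<close>.\<close>
  have "A * P * (Y * T' * Z) = B' * (T' * Z)"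
    using AP Y T'(1) Z by (simp add: B'_eq assoc_mult_mat[of _ m k _ r _ n] assoc_mult_mat[of _ k r _ r _ n])
  also have "\<dots> = B * (T * (T' * Z))"
    using B T T' Z by (simp add: BT assoc_mult_mat[of _ m r _ r _ n] assoc_mult_mat[of _ r r _ r _ n])
  also have "\<dots> = A"
    using assoc_mult_mat[OF T T'(1) Z] T'(2) Z A_eq by simp
  finally show ?thesis
    using that[of "Y * T' * Z"] Y T' Z by simp
qed

section \<open>Gram matrices and existence of the Moore-Penrose inverse\<close>

lemma scalar_prod_self_eq_0_imp:
  fixes v :: "real vec"
  assumes v: "v \<in> carrier_vec n" and "v \<bullet> v = 0"
  shows "v = 0\<^sub>v n"
proof -
  have "(\<Sum>i = 0..<n. v $ i * v $ i) = 0"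
    using assms by (simp add: scalar_prod_def)
  then have "\<forall>i\<in>{0..<n}. v $ i * v $ i = 0"
    by (subst (asm) sum_nonneg_eq_0_iff) auto
  then show ?thesis
    using v by (intro eq_vecI) auto
qed

text \<open>If the Gram matrix kills \<open>v\<close>, then pairing with \<open>v\<close> shows that
  \<open>B *\<^sub>v v\<close> has scalar product 0 with itself, so it vanishes over the
  reals.\<close>

lemma trivial_kernel_gram:
  fixes B :: "real mat"
  assumes B: "B \<in> carrier_mat m r" "trivial_kernel B"
  shows "trivial_kernel (transpose_mat B * B)"
  unfolding trivial_kernel_def
proof (intro ballI impI)
  fix v :: "real vec"
  assume "v \<in> carrier_vec (dim_col (transpose_mat B * B))"
    and z: "(transpose_mat B * B) *\<^sub>v v = 0\<^sub>v (dim_row (transpose_mat B * B))"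
  then have v: "v \<in> carrier_vec r" using B by simp
  have Bv: "B *\<^sub>v v \<in> carrier_vec m" using B v by simp
  have "transpose_mat B *\<^sub>v (B *\<^sub>v v) = 0\<^sub>v r"
    using z B v by (subst assoc_mult_mat_vec[symmetric, of _ r m _ r]) auto
  then have "(B *\<^sub>v v) \<bullet> (B *\<^sub>v v) = 0"
    using transpose_vec_mult_scalar[OF B(1) v Bv] v by simp
  then have "B *\<^sub>v v = 0\<^sub>v m"
    by (rule scalar_prod_self_eq_0_imp[OF Bv])
  then show "v = 0\<^sub>v (dim_col (transpose_mat B * B))"
    using B v by (auto simp: trivial_kernel_def)
qed

lemma gram_inverse:
  fixes B :: "real mat"
  assumes B: "B \<in> carrier_mat m r" "trivial_kernel B"
  obtains G where "G \<in> carrier_mat r r" "transpose_mat G = G"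
    "G * (transpose_mat B * B) = 1\<^sub>m r"
proof -
  define H where "H = transpose_mat B * B"
  have H: "H \<in> carrier_mat r r" "transpose_mat H = H"
    using B transpose_mult[of "transpose_mat B" r m B r] by (auto simp: H_def)
  obtain G where G: "G \<in> carrier_mat r r" "H * G = 1\<^sub>m r"
    using trivial_kernel_imp_right_inverse[OF H(1)] trivial_kernel_gram[OF B] by (auto simp: H_def)
  \<comment> \<open>Transposing \<open>H * G = 1\<^sub>m r\<close> with \<open>H\<close> symmetric
    makes the transpose of \<open>G\<close> a left inverse of \<open>H\<close>. It therefore equals
    the right inverse \<open>G\<close>, which is thus symmetric.\<close>
  have GT: "transpose_mat G * H = 1\<^sub>m r"
    using transpose_mult[OF H(1) G(1)] G(2) H(2) by simp
  have "transpose_mat G = transpose_mat G * (H * G)"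
    using G by simp
  also have "\<dots> = G"
    using assoc_mult_mat[of "transpose_mat G" r r H r G r] GT G H by simp
  finally show ?thesis
    using that[of G] G(1) GT by (simp add: H_def)
qed

text \<open>This secures two of the four Penrose conditions. The left inverse \<open>K\<close> of
  \<open>B\<close> built from its Gram matrix makes \<open>B * K\<close> the orthogonal projection
  onto the column space of \<open>M\<close>, and \<open>X = Y * K\<close> satisfies
  \<open>M * X = B * K\<close>.\<close>

lemma projection_inverse_exists:
  fixes M :: "real mat"
  assumes M: "M \<in> carrier_mat m n"
  obtains X where "X \<in> carrier_mat n m" "M * X * M = M" "transpose_mat (M * X) = M * X"
proof -
  define r where "r = mat_rank M"
  obtain B Y Z where B: "B \<in> carrier_mat m r" and Z: "Z \<in> carrier_mat r n"
    and Y: "Y \<in> carrier_mat n r" and M_eq: "M = B * Z" and B_eq: "B = M * Y"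
    and ker: "trivial_kernel B"
    using vec_space.full_rank_factorization[OF M] M unfolding r_def by (metis carrier_matD(1))
  obtain G where G: "G \<in> carrier_mat r r" "transpose_mat G = G"
    "G * (transpose_mat B * B) = 1\<^sub>m r"
    using gram_inverse[OF B ker] by blast
  define K where "K = G * transpose_mat B"
  have K: "K \<in> carrier_mat r m" "transpose_mat K = B * G"
    using transpose_mult[OF G(1), of "transpose_mat B" m] B G by (auto simp: K_def)
  have KB: "K * B = 1\<^sub>m r"
    using G B by (simp add: K_def assoc_mult_mat[of _ r r _ m _ r])
  have MX: "M * (Y * K) = B * K"
    using assoc_mult_mat[OF M Y K(1)] B_eq by simp
  have "transpose_mat (B * K) = B * G * transpose_mat B"
    using transpose_mult[OF B K(1)] K(2) by simp
  also have "\<dots> = B * K"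
    using B G by (simp add: K_def assoc_mult_mat[of _ m r _ r _ m])
  finally have sym: "transpose_mat (B * K) = B * K" .
  have "B * K * M = B * (K * (B * Z))"
    using assoc_mult_mat[OF B K(1) M] M_eq by simp
  also have "\<dots> = M"
    using assoc_mult_mat[OF K(1) B Z] KB Z M_eq by simp
  finally show ?thesis
    using that[of "Y * K"] sym MX Y K by simp
qed

text \<open>Let \<open>X\<close> satisfy \<open>M * X * M = M\<close> with \<open>M * X\<close>
  symmetric, and \<open>N\<close> satisfy \<open>M * N * M = M\<close> with \<open>N * M\<close>
  symmetric. Then \<open>N * M * X\<close> is the Moore-Penrose inverse, since multiplying it by
  \<open>M\<close> on the left leaves \<open>M * X\<close> and on the right leaves
  \<open>N * M\<close>.\<close>

lemma is_mp_inverse_exists: "\<exists>X. is_mp_inverse M X"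
proof -
  define m n where "m = dim_row M" and "n = dim_col M"
  have M: "M \<in> carrier_mat m n" by (simp add: m_def n_def)
  obtain X where X: "X \<in> carrier_mat n m" "M * X * M = M" "transpose_mat (M * X) = M * X"
    using projection_inverse_exists[OF M] by blast
  have MT: "transpose_mat M \<in> carrier_mat n m" using M by simp
  obtain N' where N': "N' \<in> carrier_mat m n" "transpose_mat M * N' * transpose_mat M = transpose_mat M"
    "transpose_mat (transpose_mat M * N') = transpose_mat M * N'"
    using projection_inverse_exists[OF MT] by blast
  \<comment> \<open>Transposing the conditions on \<open>N'\<close>, which belong to the transpose
    of \<open>M\<close>, moves the symmetry from the left product to the right product.\<close>
  define N where "N = transpose_mat N'"
  have N: "N \<in> carrier_mat n m" using N' by (simp add: N_def)
  have NM: "N * M = transpose_mat M * N'"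
    using transpose_mult[OF MT N'(1)] N'(3) by (simp add: N_def)
  have NM_carrier: "N * M \<in> carrier_mat n n" and MX_carrier: "M * X \<in> carrier_mat m m"
    using N M X by auto
  have "M * (N * M) = transpose_mat (transpose_mat M * N' * transpose_mat M)"
    using transpose_mult[of "transpose_mat M * N'" n n "transpose_mat M" m] MT N' NM by simp
  then have MNM: "M * (N * M) = M"
    using N'(2) by simp
  have MP: "M * (N * M * X) = M * X"
    using assoc_mult_mat[OF M NM_carrier X(1)] MNM by simp
  have "N * M * X * M = N * (M * X * M)"
    using assoc_mult_mat[OF N M X(1)] assoc_mult_mat[OF N MX_carrier M] by simp
  then have PM: "N * M * X * M = N * M"
    using X(2) by simp
  have "N * M * (N * M * X) = N * (M * (N * M * X))"
    using N M X by (intro assoc_mult_mat) auto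
  also have "\<dots> = N * M * X"
    using MP assoc_mult_mat[OF N M X(1)] by simp
  finally have "is_mp_inverse M (N * M * X)"
    using MP PM X N'(3) NM N M by (auto simp: is_mp_inverse_def)
  then show ?thesis ..
qed

section \<open>Moore-Penrose inverses of products\<close>

lemma is_mp_inverse_mp_inverse: "is_mp_inverse M (mp_inverse M)"
  unfolding mp_inverse_def
  using is_mp_inverse_exists is_mp_inverse_unique by (metis theI)

lemma mp_inverse_carrier:
  "M \<in> carrier_mat m n \<Longrightarrow> mp_inverse M \<in> carrier_mat n m"
  using is_mp_inverse_mp_inverse[of M] by (simp add: is_mp_inverse_def)

lemma mp_inverse_identities:
  "M * mp_inverse M * M = M" "mp_inverse M * M * mp_inverse M = mp_inverse M"
  "transpose_mat (M * mp_inverse M) = M * mp_inverse M"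
  "transpose_mat (mp_inverse M * M) = mp_inverse M * M"
  using is_mp_inverse_mp_inverse[of M] by (simp_all add: is_mp_inverse_def)

text \<open>The range of the inverse of \<open>Q * C\<close> lies in the row space of
  \<open>C\<close>, and \<open>mp_inverse C * C\<close> is the orthogonal projection onto that
  space.\<close>

lemma mp_inverse_absorb_left:
  assumes C: "C \<in> carrier_mat m k" and Q: "Q \<in> carrier_mat l m"
  shows "mp_inverse C * C * mp_inverse (Q * C) = mp_inverse (Q * C)"
proof -
  define W U where "W = Q * C" and "U = mp_inverse (Q * C)"
  have W: "W \<in> carrier_mat l k" using C Q by (simp add: W_def)
  have U: "U \<in> carrier_mat k l" using mp_inverse_carrier[OF W] by (simp add: U_def W_def)
  have C': "mp_inverse C \<in> carrier_mat k m" by (rule mp_inverse_carrier[OF C])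
  have E: "mp_inverse C * C \<in> carrier_mat k k" using C C' by simp
  \<comment> \<open>Replacing \<open>U * W\<close> by its transpose in \<open>U = U * W * U\<close>
    brings the transpose of \<open>C\<close> to the front; \<open>V\<close> is what remains after
    it.\<close>
  define V where "V = transpose_mat Q * transpose_mat U * U"
  have V: "V \<in> carrier_mat m l" using Q U by (auto simp: V_def)
  have "U = transpose_mat (U * W) * U"
    using mp_inverse_identities[of "Q * C"] by (simp add: U_def W_def)
  also have "\<dots> = transpose_mat C * transpose_mat Q * transpose_mat U * U"
    using transpose_mult[OF U W] transpose_mult[OF Q C] by (simp add: W_def)
  also have "\<dots> = transpose_mat C * V"
    using C Q U by (simp add: V_def assoc_mult_mat[of _ k m _ l _ k] assoc_mult_mat[of _ k m _ k _ l])
  finally have U_eq: "U = transpose_mat C * V" .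
  \<comment> \<open>This is the transpose of \<open>C * mp_inverse C * C = C\<close>, by symmetry of
    \<open>mp_inverse C * C\<close>.\<close>
  have "mp_inverse C * C * transpose_mat C = transpose_mat (C * (mp_inverse C * C))"
    using transpose_mult[OF C E] mp_inverse_identities(4)[of C] by simp
  also have "\<dots> = transpose_mat C"
    using assoc_mult_mat[OF C C' C] mp_inverse_identities(1)[of C] by simp
  finally have "mp_inverse C * C * U = U"
    using assoc_mult_mat[OF E, of "transpose_mat C" m V l] C V U_eq by simp
  then show ?thesis by (simp add: U_def)
qed

text \<open>This mirrors the previous argument: \<open>R * mp_inverse R\<close> is the orthogonal
  projection onto the column space of \<open>R\<close>, and the rows of the inverse of
  \<open>R * P\<close> are combinations of the transposed columns of \<open>R\<close>.\<close>

lemma mp_inverse_absorb_right: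
  assumes R: "R \<in> carrier_mat k n" and P: "P \<in> carrier_mat n l"
  shows "mp_inverse (R * P) * (R * mp_inverse R) = mp_inverse (R * P)"
proof -
  define W U where "W = R * P" and "U = mp_inverse (R * P)"
  have W: "W \<in> carrier_mat k l" using R P by (simp add: W_def)
  have U: "U \<in> carrier_mat l k" using mp_inverse_carrier[OF W] by (simp add: U_def W_def)
  have R': "mp_inverse R \<in> carrier_mat n k" by (rule mp_inverse_carrier[OF R])
  have E: "R * mp_inverse R \<in> carrier_mat k k" using R R' by simp
  define V where "V = U * (transpose_mat U * transpose_mat P)"
  have V: "V \<in> carrier_mat l n" using P U by (auto simp: V_def)
  have "U = U * transpose_mat (W * U)"
    using mp_inverse_identities[of "R * P"] assoc_mult_mat[OF U W U] by (simp add: U_def W_def)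
  also have "\<dots> = U * (transpose_mat U * (transpose_mat P * transpose_mat R))"
    using transpose_mult[OF W U] transpose_mult[OF R P] by (simp add: W_def)
  also have "\<dots> = V * transpose_mat R"
    using R P U by (simp add: V_def assoc_mult_mat[of _ k l _ n _ k] assoc_mult_mat[of _ l k _ n _ k])
  finally have U_eq: "U = V * transpose_mat R" .
  have "transpose_mat R * (R * mp_inverse R) = transpose_mat (R * mp_inverse R * R)"
    using transpose_mult[OF E R] mp_inverse_identities(3)[of R] by simp
  also have "\<dots> = transpose_mat R"
    using mp_inverse_identities(1)[of R] by simp
  finally have "U * (R * mp_inverse R) = U"
    using assoc_mult_mat[OF V _ E, of "transpose_mat R"] R U_eq by simp
  then show ?thesis by (simp add: U_def)
qed

section \<open>The decomposition for real matrices\<close>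

lemma real_cur_decomposition:
  fixes M :: "real mat"
  assumes M: "M \<in> carrier_mat m n" and P: "P \<in> carrier_mat n k" and Q: "Q \<in> carrier_mat l m"
    and rank: "mat_rank (Q * M * P) = mat_rank M"
  defines "C \<equiv> M * P" and "R \<equiv> Q * M" and "W \<equiv> Q * M * P"
  shows "mp_inverse W = mp_inverse C * M * mp_inverse R" "M = C * mp_inverse W * R"
proof -
  define U where "U = mp_inverse W"
  have C: "C \<in> carrier_mat m k" and R: "R \<in> carrier_mat l n" and W: "W \<in> carrier_mat l k"
    using M P Q by (auto simp: C_def R_def W_def)
  have U: "U \<in> carrier_mat k l" using mp_inverse_carrier[OF W] by (simp add: U_def)
  have W_RP: "W = R * P" by (simp add: W_def R_def)
  have W_QC: "W = Q * C" using assoc_mult_mat[OF Q M P] by (simp add: W_def C_def)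
  \<comment> \<open>Both ranks lie between \<open>mat_rank W\<close> and \<open>mat_rank M\<close>,
    which agree.\<close>
  have "mat_rank C = mat_rank M" "mat_rank R = mat_rank M"
    using mat_rank_mult_le_left[OF M P] mat_rank_mult_le_right[OF C Q]
      mat_rank_mult_le_right[OF M Q] mat_rank_mult_le_left[OF R P] rank
    unfolding W_def[symmetric] C_def[symmetric] R_def[symmetric]
    unfolding W_QC[symmetric] W_RP[symmetric] by linarith+
  obtain Y where Y: "Y \<in> carrier_mat k n" "M = C * Y"
    using mat_rank_mult_eq_imp_factor[OF M P] \<open>mat_rank C = _\<close> by (auto simp: C_def)
  obtain Z where Z: "Z \<in> carrier_mat m l" "M = Z * R"
  proof -
    \<comment> \<open>The row factorization is the column factorization of the transpose.\<close>
    have "mat_rank (transpose_mat M * transpose_mat Q) = mat_rank (transpose_mat M)"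
      using \<open>mat_rank R = _\<close> transpose_mult[OF Q M] mat_rank_transpose[of M]
        mat_rank_transpose[of "Q * M"] by (simp add: R_def)
    then obtain Z' where Z': "Z' \<in> carrier_mat l m"
      "transpose_mat M = transpose_mat M * transpose_mat Q * Z'"
      using mat_rank_mult_eq_imp_factor[of "transpose_mat M" n m "transpose_mat Q" l] M Q by auto
    then have "transpose_mat M = transpose_mat R * Z'"
      using transpose_mult[OF Q M] by (simp add: R_def)
    then have "M = transpose_mat Z' * R"
      using transpose_mult[of "transpose_mat R" n l Z' m] R Z'(1) by (metis transpose_carrier_mat transpose_transpose)
    then show ?thesis using that[of "transpose_mat Z'"] Z'(1) by simp
  qed
  have C_eq: "C = Z * W"
    using assoc_mult_mat[OF Z(1) R P] Z(2) W_RP by (simp add: C_def)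
  have R_eq: "R = W * Y"
    using assoc_mult_mat[OF Q C Y(1)] Y(2) W_QC by (simp add: R_def)
  have "C * U * R = Z * (W * U * W) * Y"
    using Z(1) W U Y(1) by (simp add: C_eq R_eq assoc_mult_mat[of _ m l _ k _ l]
        assoc_mult_mat[of _ m l _ k _ n] assoc_mult_mat[of _ m l _ l _ n] assoc_mult_mat[of _ m l _ l _ k]
        assoc_mult_mat[of _ l k _ l _ k] assoc_mult_mat[of _ l k _ k _ n] assoc_mult_mat[of _ l k _ l _ n] assoc_mult_mat[of _ k l _ k _ n])
  also have "\<dots> = C * Y"
    using mp_inverse_identities(1)[of W] C_eq by (simp add: U_def)
  finally show M_eq: "M = C * mp_inverse W * R"
    using Y(2) by (simp add: U_def)
  have C': "mp_inverse C \<in> carrier_mat k m" and R': "mp_inverse R \<in> carrier_mat n l"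
    using mp_inverse_carrier C R by blast+
  have "mp_inverse C * M * mp_inverse R = mp_inverse C * (C * U * R) * mp_inverse R"
    using M_eq by (simp add: U_def)
  also have "\<dots> = mp_inverse C * C * U * (R * mp_inverse R)"
    using C C' R R' U by (simp add: assoc_mult_mat[of _ k m _ n _ l] assoc_mult_mat[of _ m k _ l _ n]
        assoc_mult_mat[of _ m k _ n _ l] assoc_mult_mat[of _ k l _ n _ l] assoc_mult_mat[of _ k m _ k _ l]
        assoc_mult_mat[of _ k m _ l _ l] assoc_mult_mat[of _ m k _ l _ l])
  also have "\<dots> = mp_inverse W"
    using mp_inverse_absorb_left[OF C Q] mp_inverse_absorb_right[OF R P] W_QC W_RP
    by (simp add: U_def)
  finally show "mp_inverse W = mp_inverse C * M * mp_inverse R" ..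
qed

section \<open>Transfer to split quaternion matrices\<close>

lemma split_quat_sel_sum:
  "sq1 (sum f S) = (\<Sum>x\<in>S. sq1 (f x))" "sq2 (sum f S) = (\<Sum>x\<in>S. sq2 (f x))"
  "sq3 (sum f S) = (\<Sum>x\<in>S. sq3 (f x))" "sq4 (sum f S) = (\<Sum>x\<in>S. sq4 (f x))"
  by (induction S rule: infinite_finite_induct) auto

lemma split_quat_sel_times:
  "sq1 (p * q) = sq1 p * sq1 q - sq2 p * sq2 q + sq3 p * sq3 q + sq4 p * sq4 q"
  "sq2 (p * q) = sq1 p * sq2 q + sq2 p * sq1 q - sq3 p * sq4 q + sq4 p * sq3 q"
  "sq3 (p * q) = sq1 p * sq3 q + sq3 p * sq1 q - sq2 p * sq4 q + sq4 p * sq2 q"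
  "sq4 (p * q) = sq1 p * sq4 q + sq4 p * sq1 q + sq2 p * sq3 q - sq3 p * sq2 q"
  by (simp_all add: times_split_quat_def)

text \<open>For a single entry, \<open>real_rep\<close> sends \<open>sq_i\<close>,
  \<open>sq_j\<close>, \<open>sq_k\<close> to the real matrices with rows (0, -1), (1, 0); (1, 0),
  (0, -1); (0, 1), (1, 0), which satisfy the same multiplication table. For matrices, the four
  blocks are compared entry by entry.\<close>

lemma real_rep_mult:
  assumes A: "A \<in> carrier_mat m n" and B: "B \<in> carrier_mat n k"
  shows "real_rep (A * B) = real_rep A * real_rep B"
  unfolding real_rep_def Let_def
  by (subst mult_four_block_mat[of _ m n _ n _ m _ _ k _ k])
    (use A B in \<open>auto intro!: arg_cong4[where f = four_block_mat] eq_matI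
      simp: scalar_prod_def split_quat_sel_sum split_quat_sel_times sum.distrib sum_subtractf
        sum_negf algebra_simps\<close>)

lemma real_rep_inject: "real_rep A = real_rep B \<longleftrightarrow> A = B"
  by (metis real_rep_inv_real_rep)

lemma sq_mp_inverse_carrier:
  assumes "A \<in> carrier_mat m n"
  shows "sq_mp_inverse A \<in> carrier_mat n m"
  unfolding sq_mp_inverse_def
  by (intro real_rep_real_rep_inv mp_inverse_carrier real_rep_carrier assms)

text \<open>Both dimensions of \<open>mp_inverse (real_rep A)\<close> are even, so it lies in the
  range of \<open>real_rep\<close>, where \<open>real_rep_inv\<close> is a genuine inverse.\<close>

lemma real_rep_sq_mp_inverse: "real_rep (sq_mp_inverse A) = mp_inverse (real_rep A)"
  unfolding sq_mp_inverse_def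
  by (intro real_rep_real_rep_inv(2)[of _ "dim_col A" "dim_row A"] mp_inverse_carrier
      real_rep_carrier) simp

text \<open>With an identity matrix for \<open>B\<close>, this turns the selection of columns into a
  right multiplication.\<close>

lemma submatrix_mult_cols:
  fixes A B :: "'a :: semiring_0 mat"
  assumes "dim_col A = dim_row B"
  shows "submatrix (A * B) UNIV J = A * submatrix B UNIV J"
  using assms by (intro eq_matI)
    (auto simp: dim_submatrix submatrix_index scalar_prod_def pick_UNIV pick_le)

lemma submatrix_mult_rows:
  fixes A B :: "'a :: semiring_0 mat"
  assumes "dim_col A = dim_row B"
  shows "submatrix (A * B) I UNIV = submatrix A I UNIV * B"
  using assms by (intro eq_matI)
    (auto simp: dim_submatrix submatrix_index scalar_prod_def pick_UNIV pick_le)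

theorem theorem5p3:
  fixes A C R W :: "split_quat mat" and m n k :: nat and rs cs :: "nat set"
  assumes "A \<in> carrier_mat m n"
    and "cs \<subseteq> {..<n}" and "rs \<subseteq> {..<m}"
    and "card cs = k" and "card rs = k"
    and "C = submatrix A UNIV cs"
    and "R = submatrix A rs UNIV"
    and "W = submatrix A rs cs"
    and "rank_sigma W = rank_sigma A"
  shows "sq_mp_inverse W = sq_mp_inverse C * A * sq_mp_inverse R \<and> A = C * sq_mp_inverse W * R"
proof -
  note A = assms(1)
  define P Q :: "split_quat mat"
    where "P = submatrix (1\<^sub>m n) UNIV cs" and "Q = submatrix (1\<^sub>m m) rs UNIV"
  \<comment> \<open>\<open>submatrix\<close> ignores indices out of range, so \<open>P\<close> has
    \<open>k\<close> columns and \<open>Q\<close> has \<open>k\<close> rows only because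
    \<open>cs\<close> and \<open>rs\<close> lie within the dimensions of \<open>A\<close>.\<close>
  have "{j. j < n \<and> j \<in> cs} = cs" "{i. i < m \<and> i \<in> rs} = rs"
    using assms(2,3) by auto
  then have P: "P \<in> carrier_mat n k" and Q: "Q \<in> carrier_mat k m"
    using assms(4,5) by (auto simp: P_def Q_def dim_submatrix)
  have C_eq: "C = A * P"
    using submatrix_mult_cols[of A "1\<^sub>m n" cs] A by (simp add: assms(6) P_def)
  have R_eq: "R = Q * A"
    using submatrix_mult_rows[of "1\<^sub>m m" A rs] A by (simp add: assms(7) Q_def)
  \<comment> \<open>The matrix \<open>W\<close> consists of the rows \<open>rs\<close> of
    \<open>C\<close>, so it is \<open>Q * C\<close>.\<close>
  have W_eq: "W = Q * A * P"
    using submatrix_mult_rows[of "1\<^sub>m m" C rs] A P assoc_mult_mat[OF Q A P]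
    by (simp add: assms(8) submatrix_split[of A rs cs] assms(6)[symmetric] Q_def C_eq)
  have C: "C \<in> carrier_mat m k" and R: "R \<in> carrier_mat k n" and W: "W \<in> carrier_mat k k"
    using A P Q by (auto simp: C_eq R_eq W_eq)
  have rep: "real_rep C = real_rep A * real_rep P" "real_rep R = real_rep Q * real_rep A"
    "real_rep W = real_rep Q * real_rep A * real_rep P"
    by (simp_all only: C_eq R_eq W_eq real_rep_mult[OF Q A] real_rep_mult[OF A P]
        real_rep_mult[OF mult_carrier_mat[OF Q A] P])
  have rank: "mat_rank (real_rep Q * real_rep A * real_rep P) = mat_rank (real_rep A)"
    using assms(9) by (simp only: rank_sigma_def rep)
  note cur = real_cur_decomposition[OF real_rep_carrier[OF A] real_rep_carrier[OF P]
      real_rep_carrier[OF Q] rank, folded rep]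
  have Ci: "sq_mp_inverse C \<in> carrier_mat k m" and Ri: "sq_mp_inverse R \<in> carrier_mat n k"
    and Wi: "sq_mp_inverse W \<in> carrier_mat k k"
    using sq_mp_inverse_carrier C R W by blast+
  have "real_rep (sq_mp_inverse W) = real_rep (sq_mp_inverse C * A * sq_mp_inverse R)"
    using cur(1) by (simp only: real_rep_sq_mp_inverse real_rep_mult[OF Ci A]
        real_rep_mult[OF mult_carrier_mat[OF Ci A] Ri])
  moreover have "real_rep A = real_rep (C * sq_mp_inverse W * R)"
    using cur(2) by (simp only: real_rep_sq_mp_inverse real_rep_mult[OF C Wi]
        real_rep_mult[OF mult_carrier_mat[OF C Wi] R])
  ultimately show ?thesis
    by (simp only: real_rep_inject)
qed

end
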